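(* Let $\{E_J,\pi^K_J\}_{J,K\in A}$ be a perfect inverse system with projective limit $E_A$, and let $\{L_J,\hat E_J^0\}_{J\in A}$ be a projective system of functionals on it. Then a projective extension of $\{L_J,\hat E_J^0\}_{J\in A}$ exists. It is the functional $(L,D(L))$ defined (unambiguously) by $$D(L):=\mathcal{C}_0=\{f\in \hat E_A : \text{there exist } J\in A,\ f_J\in \hat E_J^0 \text{ with } f=\mathcal{E}_J^A f_J\},$$ $$L(f):=L_J(f_J)\qquad\text{whenever } f=\mathcal{E}_J^A f_J,\ J\in A,\ f_J\in\hat E_J^0 .$$ This functional is minimal in the sense that any other projective extension $(L',D(L'))$ of $\{L_J,\hat E_J^0\}_{J\in A}$ satisfies $D(L)\subseteq D(L')$ and $L'(f)=L(f)$ for all $f\in D(L)$.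
   Context: Projective families. A directed set $A$ is a partially ordered set $(A,\le)$ such that for all $J,K\in A$ there is $R\in A$ with $J\le R$, $K\le R$. A projective (inverse) family of sets $\{E_J,\pi^K_J\}_{J,K\in A}$ consists of non-empty sets $E_J$ indexed by a non-empty directed set $A$ and, for every $J\le K$, a surjective map $\pi^K_J:E_K\to E_J$, such that $\pi^K_K=\mathrm{id}_{E_K}$ and $\pi^R_J=\pi^K_J\circ\pi^R_K$ for $J\le K\le R$. Its projective limit is $$E_A:=\{(x_J)_{J\in A}\in\prod_{J\in A}E_J : x_J=\pi^K_J(x_K)\ \text{for all } J\le K\},$$ and $\pi_J:E_A\to E_J$ denotes the restriction to $E_A$ of the coordinate projection; $\pi_J=\pi^K_J\circ\pi_K$ for $J\le K$. The family is called a perfect inverse system if for every $J\in A$ and $x_J\in E_J$ there is $x\in E_A$ with $\pi_J x=x_J$. Functions and extension maps. $\hat E_J$ (resp. $\hat E_A$) is the space of all functions $E_J\to\mathbb{C}$ (resp. $E_A\to\mathbb{C}$). For $J\le K$ the map $\mathcal{E}_J^K:\hat E_J\to\hat E_K$ is $\mathcal{E}_J^K(f_J):=f_J\circ\pi^K_J$, and $\mathcal{E}_J^A:\hat E_J\to\hat E_A$ is $\mathcal{E}_J^A f_J:=f_J\circ\pi_J$. Functionals. A functional is a complex-valued linear map defined on a linear subspace (its domain) of a space of complex-valued functions. A projective system of functionals $\{L_J,\hat E_J^0\}_{J\in A}$ is a family of functionals $L_J:\hat E_J^0\to\mathbb{C}$ with domain $\hat E_J^0\subseteq\hat E_J$ such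 that for all $J\le K$ and all $f_J\in\hat E_J^0$: $\mathcal{E}_J^K(f_J)\in\hat E_K^0$ and $L_K(\mathcal{E}_J^K(f_J))=L_J(f_J)$. Projective extensions. Put $\mathcal{C}_0:=\bigcup_{J\in A}\mathcal{E}_J^A(\hat E_J^0)\subseteq\hat E_A$. A projective extension of $\{L_J,\hat E_J^0\}_{J\in A}$ is a functional $L$ with domain $D(L)\subseteq\hat E_A$ such that $\mathcal{C}_0\subseteq D(L)$ and $L(\mathcal{E}_J^A f_J)=L_J(f_J)$ for all $J\in A$, $f_J\in\hat E_J^0$. *)

theory Defs
  imports Complex_Main "HOL-Library.FuncSet"
begin

(* A complex-valued function on a set X is an element of X \<rightarrow>\<^sub>E UNIV, i.e. it takes the
   value undefined outside X, so that equality in HOL is equality of functions on X.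
   Sums and multiples are therefore formed pointwise on X and then restricted to X. *)

definition linear_subspace :: "'x set \<Rightarrow> ('x \<Rightarrow> complex) set \<Rightarrow> bool" where
  "linear_subspace X D \<longleftrightarrow>
     D \<subseteq> X \<rightarrow>\<^sub>E UNIV \<and>
     (\<lambda>x\<in>X. 0) \<in> D \<and>
     (\<forall>f\<in>D. \<forall>g\<in>D. (\<lambda>x\<in>X. f x + g x) \<in> D) \<and>
     (\<forall>c. \<forall>f\<in>D. (\<lambda>x\<in>X. c * f x) \<in> D)"

(* Only the values of L on its domain D are meaningful. *)

definition functional ::
  "'x set \<Rightarrow> ('x \<Rightarrow> complex) set \<Rightarrow> (('x \<Rightarrow> complex) \<Rightarrow> complex) \<Rightarrow> bool" where
  "functional X D L \<longleftrightarrow>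
     linear_subspace X D \<and>
     (\<forall>f\<in>D. \<forall>g\<in>D. L (\<lambda>x\<in>X. f x + g x) = L f + L g) \<and>
     (\<forall>c. \<forall>f\<in>D. L (\<lambda>x\<in>X. c * f x) = c * L f)"

(* r is the order relation: J \<le> K is (J, K) \<in> r. *)

definition directed_set :: "'i set \<Rightarrow> ('i \<times> 'i) set \<Rightarrow> bool" where
  "directed_set A r \<longleftrightarrow>
     partial_order_on A r \<and>
     (\<forall>J\<in>A. \<forall>K\<in>A. \<exists>R\<in>A. (J, R) \<in> r \<and> (K, R) \<in> r)"

(* p J K is the map from E K to E J, for J \<le> K; the sets E J are subsets of a common type. *)

definition projective_family ::
  "'i set \<Rightarrow> ('i \<times> 'i) set \<Rightarrow> ('i \<Rightarrow> 'b set) \<Rightarrow> ('i \<Rightarrow> 'i \<Rightarrow> 'b \<Rightarrow> 'b) \<Rightarrow> bool" where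
  "projective_family A r E p \<longleftrightarrow>
     A \<noteq> {} \<and> directed_set A r \<and>
     (\<forall>J\<in>A. E J \<noteq> {}) \<and>
     (\<forall>J K. (J, K) \<in> r \<longrightarrow> p J K ` E K = E J) \<and>
     (\<forall>K\<in>A. \<forall>x\<in>E K. p K K x = x) \<and>
     (\<forall>J K R. (J, K) \<in> r \<longrightarrow> (K, R) \<in> r \<longrightarrow> (\<forall>x\<in>E R. p J R x = p J K (p K R x)))"

definition projective_limit ::
  "'i set \<Rightarrow> ('i \<times> 'i) set \<Rightarrow> ('i \<Rightarrow> 'b set) \<Rightarrow> ('i \<Rightarrow> 'i \<Rightarrow> 'b \<Rightarrow> 'b) \<Rightarrow> ('i \<Rightarrow> 'b) set" where
  "projective_limit A r E p =
     {x \<in> Pi\<^sub>E A E. \<forall>J K. (J, K) \<in> r \<longrightarrow> x J = p J K (x K)}"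

definition perfect_inverse_system ::
  "'i set \<Rightarrow> ('i \<times> 'i) set \<Rightarrow> ('i \<Rightarrow> 'b set) \<Rightarrow> ('i \<Rightarrow> 'i \<Rightarrow> 'b \<Rightarrow> 'b) \<Rightarrow> bool" where
  "perfect_inverse_system A r E p \<longleftrightarrow>
     projective_family A r E p \<and>
     (\<forall>J\<in>A. \<forall>xJ\<in>E J. \<exists>x\<in>projective_limit A r E p. x J = xJ)"

definition ext_map ::
  "('i \<Rightarrow> 'b set) \<Rightarrow> ('i \<Rightarrow> 'i \<Rightarrow> 'b \<Rightarrow> 'b) \<Rightarrow> 'i \<Rightarrow> 'i \<Rightarrow> ('b \<Rightarrow> complex) \<Rightarrow> ('b \<Rightarrow> complex)" where
  "ext_map E p J K f = compose (E K) f (p J K)"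

definition lim_ext_map ::
  "'i set \<Rightarrow> ('i \<times> 'i) set \<Rightarrow> ('i \<Rightarrow> 'b set) \<Rightarrow> ('i \<Rightarrow> 'i \<Rightarrow> 'b \<Rightarrow> 'b) \<Rightarrow>
   'i \<Rightarrow> ('b \<Rightarrow> complex) \<Rightarrow> (('i \<Rightarrow> 'b) \<Rightarrow> complex)" where
  "lim_ext_map A r E p J f = compose (projective_limit A r E p) f (\<lambda>x. x J)"

(* The functional with index J is LJ J, with domain D0 J. *)

definition projective_system_of_functionals ::
  "'i set \<Rightarrow> ('i \<times> 'i) set \<Rightarrow> ('i \<Rightarrow> 'b set) \<Rightarrow> ('i \<Rightarrow> 'i \<Rightarrow> 'b \<Rightarrow> 'b) \<Rightarrow>
   ('i \<Rightarrow> ('b \<Rightarrow> complex) set) \<Rightarrow> ('i \<Rightarrow> ('b \<Rightarrow> complex) \<Rightarrow> complex) \<Rightarrow> bool" where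
  "projective_system_of_functionals A r E p D0 LJ \<longleftrightarrow>
     (\<forall>J\<in>A. functional (E J) (D0 J) (LJ J)) \<and>
     (\<forall>J K. (J, K) \<in> r \<longrightarrow>
        (\<forall>f\<in>D0 J. ext_map E p J K f \<in> D0 K \<and> LJ K (ext_map E p J K f) = LJ J f))"

definition cylinder_functions ::
  "'i set \<Rightarrow> ('i \<times> 'i) set \<Rightarrow> ('i \<Rightarrow> 'b set) \<Rightarrow> ('i \<Rightarrow> 'i \<Rightarrow> 'b \<Rightarrow> 'b) \<Rightarrow>
   ('i \<Rightarrow> ('b \<Rightarrow> complex) set) \<Rightarrow> (('i \<Rightarrow> 'b) \<Rightarrow> complex) set" where
  "cylinder_functions A r E p D0 = (\<Union>J\<in>A. lim_ext_map A r E p J ` D0 J)"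

definition projective_extension ::
  "'i set \<Rightarrow> ('i \<times> 'i) set \<Rightarrow> ('i \<Rightarrow> 'b set) \<Rightarrow> ('i \<Rightarrow> 'i \<Rightarrow> 'b \<Rightarrow> 'b) \<Rightarrow>
   ('i \<Rightarrow> ('b \<Rightarrow> complex) set) \<Rightarrow> ('i \<Rightarrow> ('b \<Rightarrow> complex) \<Rightarrow> complex) \<Rightarrow>
   (('i \<Rightarrow> 'b) \<Rightarrow> complex) set \<Rightarrow> ((('i \<Rightarrow> 'b) \<Rightarrow> complex) \<Rightarrow> complex) \<Rightarrow> bool" where
  "projective_extension A r E p D0 LJ D L \<longleftrightarrow>
     functional (projective_limit A r E p) D L \<and>
     cylinder_functions A r E p D0 \<subseteq> D \<and>
     (\<forall>J\<in>A. \<forall>f\<in>D0 J. L (lim_ext_map A r E p J f) = LJ J f)"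

end

theory Submission
  imports Defs
begin

text \<open>By perfectness the maps \<^term>\<open>lim_ext_map A r E p J\<close> are injective, and by directedness any two
  cylinder functions are extensions of functions on one common \<open>E\<^sub>R\<close>. So the value of the
  functional does not depend on the representation, and linearity is inherited from \<open>L\<^sub>R\<close>.\<close>

locale functionals_on_perfect_system =
  fixes A :: "'i set" and r :: "('i \<times> 'i) set"
    and E :: "'i \<Rightarrow> 'b set" and p :: "'i \<Rightarrow> 'i \<Rightarrow> 'b \<Rightarrow> 'b"
    and D0 :: "'i \<Rightarrow> ('b \<Rightarrow> complex) set"
    and LJ :: "'i \<Rightarrow> ('b \<Rightarrow> complex) \<Rightarrow> complex"
  assumes perfect: "perfect_inverse_system A r E p"
    and system: "projective_system_of_functionals A r E p D0 LJ"
begin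

abbreviation EA :: "('i \<Rightarrow> 'b) set" where
  "EA \<equiv> projective_limit A r E p"

abbreviation ext :: "'i \<Rightarrow> ('b \<Rightarrow> complex) \<Rightarrow> ('i \<Rightarrow> 'b) \<Rightarrow> complex" where
  "ext \<equiv> lim_ext_map A r E p"

abbreviation C0 :: "(('i \<Rightarrow> 'b) \<Rightarrow> complex) set" where
  "C0 \<equiv> cylinder_functions A r E p D0"

text \<open>A partial order on \<open>A\<close> relates only elements of \<open>A\<close>, so
  \<open>(J, K) \<in> r\<close> already carries the membership of both indices.\<close>

lemma rel_in_index_set: "(J, K) \<in> r \<Longrightarrow> J \<in> A \<and> K \<in> A"
  using perfect
  by (auto simp: perfect_inverse_system_def projective_family_def directed_set_def
      partial_order_on_def preorder_on_def)

lemma upper_bound: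
  assumes "J \<in> A" "K \<in> A"
  obtains R where "R \<in> A" "(J, R) \<in> r" "(K, R) \<in> r"
proof -
  have "directed_set A r"
    using perfect by (simp add: perfect_inverse_system_def projective_family_def)
  then show thesis
    using assms that unfolding directed_set_def by blast
qed

lemma index_set_nonempty: "A \<noteq> {}"
  using perfect by (simp add: perfect_inverse_system_def projective_family_def)

lemma functional_LJ: "J \<in> A \<Longrightarrow> functional (E J) (D0 J) (LJ J)"
  using system by (simp add: projective_system_of_functionals_def)

lemma linear_subspace_D0: "J \<in> A \<Longrightarrow> linear_subspace (E J) (D0 J)"
  using functional_LJ by (simp add: functional_def)

lemma
  assumes "(J, K) \<in> r" "f \<in> D0 J"
  shows ext_map_in_D0: "ext_map E p J K f \<in> D0 K"
    and LJ_ext_map: "LJ K (ext_map E p J K f) = LJ J f"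
  using assms system by (auto simp: projective_system_of_functionals_def)

lemma projective_limit_coordinate: "x \<in> EA \<Longrightarrow> J \<in> A \<Longrightarrow> x J \<in> E J"
  by (auto simp: projective_limit_def)

text \<open>This is the defining compatibility \<open>x J = p J K (x K)\<close> of points of the
  limit, read on functions. Both sides are extensional on \<open>EA\<close>, so comparing them at
  points of \<open>EA\<close> suffices; there \<open>x K\<close> lies in \<open>E K\<close>, where
  \<open>compose (E K)\<close> is not \<open>undefined\<close>.\<close>

lemma lim_ext_map_ext_map:
  assumes "(J, K) \<in> r"
  shows "ext K (ext_map E p J K f) = ext J f"
  unfolding lim_ext_map_def ext_map_def
proof (rule extensionalityI[OF compose_extensional compose_extensional])
  fix x assume x: "x \<in> EA"
  then have "x J = p J K (x K)"
    using assms by (auto simp: projective_limit_def)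
  then show "compose EA (compose (E K) f (p J K)) (\<lambda>x. x K) x = compose EA f (\<lambda>x. x J) x"
    using x projective_limit_coordinate[OF x] rel_in_index_set[OF assms]
    by (simp add: compose_eq)
qed

text \<open>Perfectness makes the coordinate map from \<open>EA\<close> to \<open>E J\<close>
  surjective, so each value \<open>f y\<close> is a value of \<open>ext J f\<close> at some point
  over \<open>y\<close>. Outside \<open>E J\<close> both functions are
  \<open>undefined\<close>.\<close>

lemma lim_ext_map_inject:
  assumes J: "J \<in> A" and "f \<in> extensional (E J)" "g \<in> extensional (E J)"
    and eq: "ext J f = ext J g"
  shows "f = g"
proof (rule extensionalityI[OF assms(2,3)])
  fix y assume "y \<in> E J"
  then obtain x where x: "x \<in> EA" "x J = y"
    using perfect J by (auto simp: perfect_inverse_system_def)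
  then show "f y = g y"
    using fun_cong[OF eq, of x] by (simp add: lim_ext_map_def compose_eq)
qed

lemma D0_extensional: "J \<in> A \<Longrightarrow> f \<in> D0 J \<Longrightarrow> f \<in> extensional (E J)"
  using linear_subspace_D0[of J] by (auto simp: linear_subspace_def PiE_def)

text \<open>Well-definedness: both representatives are moved to a common upper bound
  \<open>R\<close>, where they become the same function, and the consistency of the system shows
  that neither value changes on the way.\<close>

lemma LJ_cong:
  assumes "J \<in> A" "f \<in> D0 J" "K \<in> A" "g \<in> D0 K" and eq: "ext J f = ext K g"
  shows "LJ J f = LJ K g"
proof -
  obtain R where R: "R \<in> A" "(J, R) \<in> r" "(K, R) \<in> r"
    using assms(1,3) by (rule upper_bound)
  \<comment> \<open>Both sides lie in \<open>D0 R\<close> and have the same extension to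
    \<open>EA\<close>, namely \<open>ext J f = ext K g\<close>, so injectivity of
    \<open>ext R\<close> identifies them.\<close>
  have "ext_map E p J R f = ext_map E p K R g"
    using R assms
    by (intro lim_ext_map_inject[OF R(1)])
       (auto intro: D0_extensional ext_map_in_D0 simp: lim_ext_map_ext_map)
  then show ?thesis
    using LJ_ext_map[OF R(2) assms(2)] LJ_ext_map[OF R(3) assms(4)] by simp
qed

lemma lim_ext_map_in_cylinder: "J \<in> A \<Longrightarrow> f \<in> D0 J \<Longrightarrow> ext J f \<in> C0"
  by (auto simp: cylinder_functions_def)

lemma cylinderE:
  assumes "f \<in> C0"
  obtains J fJ where "J \<in> A" "fJ \<in> D0 J" "f = ext J fJ"
  using assms by (auto simp: cylinder_functions_def)

text \<open>Needed for sums: functions with different indices can be added inside a single domain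
  \<open>D0 R\<close> only after both have been moved to an upper bound \<open>R\<close>.\<close>

lemma cylinder_common_index:
  assumes "f \<in> C0" "g \<in> C0"
  obtains R f' g' where "R \<in> A" "f' \<in> D0 R" "g' \<in> D0 R" "f = ext R f'" "g = ext R g'"
proof -
  obtain J fJ where J: "J \<in> A" "fJ \<in> D0 J" "f = ext J fJ"
    using assms(1) by (rule cylinderE)
  obtain K gK where K: "K \<in> A" "gK \<in> D0 K" "g = ext K gK"
    using assms(2) by (rule cylinderE)
  obtain R where R: "R \<in> A" "(J, R) \<in> r" "(K, R) \<in> r"
    using J(1) K(1) by (rule upper_bound)
  show thesis
    using that[OF R(1) ext_map_in_D0[OF R(2) J(2)] ext_map_in_D0[OF R(3) K(2)]]
      J(3) K(3) lim_ext_map_ext_map[OF R(2)] lim_ext_map_ext_map[OF R(3)]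
    by simp
qed

lemma lim_ext_map_in_PiE: "ext J f \<in> EA \<rightarrow>\<^sub>E UNIV"
  by (auto simp: lim_ext_map_def compose_def)

text \<open>This and the next two lemmas give the linearity of \<open>ext J\<close>. Coordinates of
  points of \<open>EA\<close> lie in \<open>E J\<close>, so the restriction to \<open>E J\<close> is
  invisible after composition and only the restriction to \<open>EA\<close> remains.\<close>

lemma lim_ext_map_zero: "J \<in> A \<Longrightarrow> ext J (\<lambda>x\<in>E J. 0) = (\<lambda>x\<in>EA. 0)"
  by (auto simp: lim_ext_map_def compose_def projective_limit_coordinate intro!: restrict_ext)

lemma lim_ext_map_add:
  "J \<in> A \<Longrightarrow> ext J (\<lambda>x\<in>E J. f x + g x) = (\<lambda>x\<in>EA. ext J f x + ext J g x)"
  by (auto simp: lim_ext_map_def compose_def projective_limit_coordinate intro!: restrict_ext)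

lemma lim_ext_map_scale:
  "J \<in> A \<Longrightarrow> ext J (\<lambda>x\<in>E J. c * f x) = (\<lambda>x\<in>EA. c * ext J f x)"
  by (auto simp: lim_ext_map_def compose_def projective_limit_coordinate intro!: restrict_ext)

lemma ex1_cylinder_value:
  assumes "f \<in> C0"
  shows "\<exists>!c. \<exists>J\<in>A. \<exists>fJ\<in>D0 J. f = ext J fJ \<and> c = LJ J fJ"
proof -
  obtain J fJ where J: "J \<in> A" "fJ \<in> D0 J" "f = ext J fJ"
    using assms by (rule cylinderE)
  show ?thesis
  proof (rule ex1I[of _ "LJ J fJ"])
    show "\<exists>K\<in>A. \<exists>g\<in>D0 K. f = ext K g \<and> LJ J fJ = LJ K g"
      using J by blast
    fix c assume "\<exists>K\<in>A. \<exists>g\<in>D0 K. f = ext K g \<and> c = LJ K g"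
    then obtain K g where K: "K \<in> A" "g \<in> D0 K" "f = ext K g" "c = LJ K g"
      by blast
    show "c = LJ J fJ"
      unfolding K(4) by (rule LJ_cong[OF K(1,2) J(1,2) trans[OF K(3)[symmetric] J(3)]])
  qed
qed

text \<open>The description is justified by \<open>ex1_cylinder_value\<close> on \<open>C0\<close>.
  Off \<open>C0\<close> the value is unspecified, which is harmless because \<open>C0\<close> is the
  domain of the functional.\<close>

definition cylinder_functional :: "(('i \<Rightarrow> 'b) \<Rightarrow> complex) \<Rightarrow> complex" where
  "cylinder_functional f = (THE c. \<exists>J\<in>A. \<exists>fJ\<in>D0 J. f = ext J fJ \<and> c = LJ J fJ)"

lemma cylinder_functional_lim_ext_map:
  assumes "J \<in> A" "f \<in> D0 J"
  shows "cylinder_functional (ext J f) = LJ J f"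
  unfolding cylinder_functional_def
  using assms by (intro the1_equality ex1_cylinder_value lim_ext_map_in_cylinder) auto

lemma functional_cylinder_functional: "functional EA C0 cylinder_functional"
proof -
  have zero: "(\<lambda>x\<in>EA. 0) \<in> C0"
  proof -
    \<comment> \<open>Any index will do: the zero function on \<open>EA\<close> is the extension of
      the zero function on \<open>E J\<close>.\<close>
    obtain J where J: "J \<in> A"
      using index_set_nonempty by auto
    then have "(\<lambda>x\<in>E J. 0) \<in> D0 J"
      using linear_subspace_D0 by (simp add: linear_subspace_def)
    with J show ?thesis
      using lim_ext_map_in_cylinder[of J "\<lambda>x\<in>E J. 0"] lim_ext_map_zero[OF J] by simp
  qed
  have add: "(\<lambda>x\<in>EA. f x + g x) \<in> C0 \<and>
      cylinder_functional (\<lambda>x\<in>EA. f x + g x) = cylinder_functional f + cylinder_functional g"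
    if fg: "f \<in> C0" "g \<in> C0" for f g
  proof -
    obtain R f' g' where R: "R \<in> A" "f' \<in> D0 R" "g' \<in> D0 R" "f = ext R f'" "g = ext R g'"
      using fg by (rule cylinder_common_index)
    \<comment> \<open>The sum is formed on \<open>E R\<close>, where \<open>LJ R\<close> is
      additive, and its extension represents the sum of \<open>f\<close> and \<open>g\<close> on
      \<open>EA\<close>.\<close>
    let ?h = "\<lambda>x\<in>E R. f' x + g' x"
    have h: "?h \<in> D0 R" "LJ R ?h = LJ R f' + LJ R g'"
      using functional_LJ[OF R(1)] R(2,3) by (auto simp: functional_def linear_subspace_def)
    have "ext R ?h = (\<lambda>x\<in>EA. f x + g x)"
      using lim_ext_map_add R by simp
    then show ?thesis
      using lim_ext_map_in_cylinder[OF R(1) h(1)] cylinder_functional_lim_ext_map[OF R(1) h(1)]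
        h(2) R cylinder_functional_lim_ext_map by simp
  qed
  have scale: "(\<lambda>x\<in>EA. c * f x) \<in> C0 \<and>
      cylinder_functional (\<lambda>x\<in>EA. c * f x) = c * cylinder_functional f"
    if f: "f \<in> C0" for c f
  proof -
    obtain J f' where J: "J \<in> A" "f' \<in> D0 J" "f = ext J f'"
      using f by (rule cylinderE)
    let ?h = "\<lambda>x\<in>E J. c * f' x"
    have h: "?h \<in> D0 J" "LJ J ?h = c * LJ J f'"
      using functional_LJ[OF J(1)] J(2) by (auto simp: functional_def linear_subspace_def)
    have "ext J ?h = (\<lambda>x\<in>EA. c * f x)"
      using lim_ext_map_scale J by simp
    then show ?thesis
      using lim_ext_map_in_cylinder[OF J(1) h(1)] cylinder_functional_lim_ext_map[OF J(1) h(1)]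
        h(2) J cylinder_functional_lim_ext_map by simp
  qed
  have "C0 \<subseteq> EA \<rightarrow>\<^sub>E UNIV"
    using lim_ext_map_in_PiE by (blast elim: cylinderE)
  with zero add scale show ?thesis
    unfolding functional_def linear_subspace_def by blast
qed

lemma projective_extension_cylinder_functional:
  "projective_extension A r E p D0 LJ C0 cylinder_functional"
  unfolding projective_extension_def
  using functional_cylinder_functional cylinder_functional_lim_ext_map by simp

text \<open>Minimality: every projective extension has the prescribed value \<open>LJ J fJ\<close>
  at \<open>ext J fJ\<close>, and all elements of \<open>C0\<close> have this form.\<close>

lemma projective_extension_cylinder_eq:
  assumes "projective_extension A r E p D0 LJ D' L'" "f \<in> C0"
  shows "L' f = cylinder_functional f"
  using assms by (auto simp: projective_extension_def cylinder_functional_lim_ext_map elim!: cylinderE)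

end

theorem theorem1:
  fixes A :: "'i set" and r :: "('i \<times> 'i) set"
    and E :: "'i \<Rightarrow> 'b set" and p :: "'i \<Rightarrow> 'i \<Rightarrow> 'b \<Rightarrow> 'b"
    and D0 :: "'i \<Rightarrow> ('b \<Rightarrow> complex) set"
    and LJ :: "'i \<Rightarrow> ('b \<Rightarrow> complex) \<Rightarrow> complex"
  assumes "perfect_inverse_system A r E p"
    and "projective_system_of_functionals A r E p D0 LJ"
  shows
    "\<exists>D L.
       D = cylinder_functions A r E p D0 \<and>
       D = {f \<in> projective_limit A r E p \<rightarrow>\<^sub>E UNIV. \<exists>J\<in>A. \<exists>fJ\<in>D0 J. f = lim_ext_map A r E p J fJ} \<and>
       (\<forall>f\<in>D. \<exists>!c. \<exists>J\<in>A. \<exists>fJ\<in>D0 J. f = lim_ext_map A r E p J fJ \<and> c = LJ J fJ) \<and>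
       (\<forall>f. \<forall>J\<in>A. \<forall>fJ\<in>D0 J. f = lim_ext_map A r E p J fJ \<longrightarrow> L f = LJ J fJ) \<and>
       projective_extension A r E p D0 LJ D L \<and>
       (\<forall>D' L'. projective_extension A r E p D0 LJ D' L' \<longrightarrow>
          D \<subseteq> D' \<and> (\<forall>f\<in>D. L' f = L f))"
proof -
  interpret functionals_on_perfect_system A r E p D0 LJ
    using assms by unfold_locales
  \<comment> \<open>Membership in the function space over \<open>EA\<close> comes for free, since
    \<open>ext J\<close> is a composition restricted to \<open>EA\<close>.\<close>
  have C0_eq: "C0 = {f \<in> EA \<rightarrow>\<^sub>E UNIV. \<exists>J\<in>A. \<exists>fJ\<in>D0 J. f = ext J fJ}"
    using lim_ext_map_in_PiE by (auto simp: cylinder_functions_def)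
  have min: "C0 \<subseteq> D' \<and> (\<forall>f\<in>C0. L' f = cylinder_functional f)"
    if "projective_extension A r E p D0 LJ D' L'" for D' L'
    using that projective_extension_cylinder_eq by (auto simp: projective_extension_def)
  show ?thesis
  proof (intro exI[of _ C0] exI[of _ cylinder_functional] conjI refl C0_eq)
    show "\<forall>f\<in>C0. \<exists>!c. \<exists>J\<in>A. \<exists>fJ\<in>D0 J. f = ext J fJ \<and> c = LJ J fJ"
      using ex1_cylinder_value by (rule ballI)
    show "\<forall>f. \<forall>J\<in>A. \<forall>fJ\<in>D0 J. f = ext J fJ \<longrightarrow> cylinder_functional f = LJ J fJ"
      using cylinder_functional_lim_ext_map by simp
    show "projective_extension A r E p D0 LJ C0 cylinder_functional"
      by (rule projective_extension_cylinder_functional)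
    show "\<forall>D' L'. projective_extension A r E p D0 LJ D' L' \<longrightarrow>
        C0 \<subseteq> D' \<and> (\<forall>f\<in>C0. L' f = cylinder_functional f)"
      using min by simp
  qed
qed

end
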